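(* Let $G$ be a connected graph, $H$ a subgraph of $G$, and $u\in V(H)$. If $H$ is connected, then $$\lambda\big(\mathfrak{M}(H,\,x\mathbf{1}_H-\mathbf{d}_{G,H})\big)=\lambda\Big(D_G\big(T(H,u)\big)+A\big(T(H,u)\big)\Big).$$ In particular, for every $u\in V(G)$, $\lambda(\mathcal{LM}(G,x))=\lambda\big(D_G(T(G,u))+A(T(G,u))\big)$. Also, the largest root of $\mathcal{LM}(G,x)$ has multiplicity $1$.
   Context: All graphs are finite, undirected, without loops or multiple edges. $V(G)$ and $E(G)$ are the vertex and edge sets and $d_G(v)$ is the degree of $v$ in $G$. A matching of $G$ is a set $M\subseteq E(G)$ (possibly empty) no two distinct edges of which share an endpoint; $V(M)$ is the set of endpoints of edges in $M$. For a graph $H$ and a vector $\mathbf{x}_H=(x_v)_{v\in V(H)}$, the multivariate matching polynomial is $$\mathfrak{M}(H,\mathbf{x}_H)=\sum_{M}(-1)^{|M|}\prod_{v\in V(H)\setminus V(M)}x_v,$$ where $M$ ranges over all matchings of $H$. $\mathbf{1}_H$ is the all-one vector indexed by $V(H)$, and for a subgraph $H$ of $G$, $\mathbf{d}_{G,H}=(d_G(v))_{v\in V(H)}$ (degrees taken in $G$). Thus $\mathfrak{M}(H,x\mathbf{1}_H-\mathbf{d}_{G,H})$ is obtained by substituting $x_v=x-d_G(v)$, and is a polynomial in the single variable $x$. The Laplacian matching polynomial of $G$ is $$\mathcal{LM}(G,x)=\mathfrak{M}(G,x\mathbf{1}_G-\mathbf{d}_{G,G})=\sum_{M}(-1)^{|M|}\prod_{v\in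 V(G)\setminus V(M)}\big(x-d_G(v)\big).$$ For a graph $H$ and $u\in V(H)$, the path-tree $T(H,u)$ is the tree whose vertices are the paths in $H$ that start at $u$ (including the trivial path $u$), two such paths being adjacent if one is a maximal proper subpath of the other. For $P\in V(T(H,u))$, $\upsilon(P)$ denotes the terminal vertex of the path $P$. For a subgraph $H$ of $G$, $D_G(T(H,u))$ is the diagonal matrix with rows and columns indexed by $V(T(H,u))$ whose $(P,P)$-entry is $d_G(\upsilon(P))$. $A(\cdot)$ denotes the adjacency matrix. For a real-rooted polynomial $f$, $\lambda(f)$ is its largest zero; for a square matrix $M$ with only real eigenvalues, $\lambda(M)$ is its largest eigenvalue. (The polynomials above are known to be real-rooted.) *)

theory Defs
  imports
    "HOL-Library.Sublist"
    "Graph_Theory.Digraph_Component"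
    "Graph_Theory.Vertex_Walk"
    "Jordan_Normal_Form.Spectral_Radius"
begin

text \<open>
  A finite simple graph is a \<^locale>\<open>pair_graph\<close>: a finite, symmetric, loop-free digraph whose arcs
  are pairs of vertices, so that an edge between v and w is represented by both arcs (v, w)
  and (w, v). Hence the number of neighbours of v is its out-degree. Being connected
  includes being nonempty.
\<close>

definition edges :: "'a pair_pre_digraph \<Rightarrow> 'a set set" where
  "edges G = {{v, w} |v w. (v, w) \<in> parcs G}"

definition deg :: "'a pair_pre_digraph \<Rightarrow> 'a \<Rightarrow> nat" where
  "deg G v = out_degree (with_proj G) v"

definition matchings :: "'a pair_pre_digraph \<Rightarrow> 'a set set set" where
  "matchings G = {M. M \<subseteq> edges G \<and> (\<forall>e\<in>M. \<forall>f\<in>M. e \<noteq> f \<longrightarrow> e \<inter> f = {})}"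

text \<open>
  The multivariate matching polynomial, as a function of the vector x with entries
  in an arbitrary commutative ring.
\<close>

definition matching_poly :: "'a pair_pre_digraph \<Rightarrow> ('a \<Rightarrow> 'r::comm_ring_1) \<Rightarrow> 'r" where
  "matching_poly H x = (\<Sum>M\<in>matchings H. (-1) ^ card M * (\<Prod>v\<in>pverts H - \<Union>M. x v))"

text \<open>
  The substitution of x - deg G v for the variable at v, with degrees taken in the
  ambient graph G; here \<open>[:0, 1:]\<close> is the polynomial indeterminate.
\<close>

definition shifted_matching_poly :: "'a pair_pre_digraph \<Rightarrow> 'a pair_pre_digraph \<Rightarrow> real poly" where
  "shifted_matching_poly G H = matching_poly H (\<lambda>v. [:0, 1:] - of_nat (deg G v))"

definition laplacian_matching_poly :: "'a pair_pre_digraph \<Rightarrow> real poly" where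
  "laplacian_matching_poly G = shifted_matching_poly G G"

text \<open>
  Paths are nonempty lists of distinct vertices (\<^const>\<open>vpath\<close>), and subpaths are contiguous
  sublists. A path starting at u is determined by its list of vertices read from u.
\<close>

definition max_proper_subpath :: "'a list \<Rightarrow> 'a list \<Rightarrow> bool" where
  "max_proper_subpath p q \<longleftrightarrow>
     strict_sublist p q \<and> \<not> (\<exists>r. strict_sublist p r \<and> strict_sublist r q)"

definition paths_from :: "'a pair_pre_digraph \<Rightarrow> 'a \<Rightarrow> 'a list set" where
  "paths_from H u = {p. vpath p (with_proj H) \<and> hd p = u}"

definition path_tree :: "'a pair_pre_digraph \<Rightarrow> 'a \<Rightarrow> 'a list pair_pre_digraph" where
  "path_tree H u =
     \<lparr>pverts = paths_from H u,
      parcs = {(p, q). p \<in> paths_from H u \<and> q \<in> paths_from H u \<and>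
                       (max_proper_subpath p q \<or> max_proper_subpath q p)}\<rparr>"

text \<open>
  Matrices in the library have rows and columns indexed by natural numbers, so the vertex set
  indexing a matrix is listed in some order; a different order yields a similar matrix.
\<close>

definition vertex_enum :: "'a pair_pre_digraph \<Rightarrow> 'a list \<Rightarrow> bool" where
  "vertex_enum T vs \<longleftrightarrow> distinct vs \<and> set vs = pverts T"

definition adjacency_mat :: "'a pair_pre_digraph \<Rightarrow> 'a list \<Rightarrow> real mat" where
  "adjacency_mat T vs =
     mat (length vs) (length vs) (\<lambda>(i, j). if (vs ! i, vs ! j) \<in> parcs T then 1 else 0)"

text \<open>
  For ps an enumeration of the vertices of a path-tree, this is the diagonal matrix of
  the degrees in G of the terminal vertices.
\<close>

definition terminal_degree_mat :: "'a pair_pre_digraph \<Rightarrow> 'a list list \<Rightarrow> real mat" where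
  "terminal_degree_mat G ps = mat_diag (length ps) (\<lambda>i. real (deg G (last (ps ! i))))"

definition largest_root :: "real poly \<Rightarrow> real" where
  "largest_root f = Max {x. poly f x = 0}"

definition largest_eigenvalue :: "real mat \<Rightarrow> real" where
  "largest_eigenvalue A = Max (spectrum A)"

end

theory Submission
  imports Defs
begin

text \<open>
  Write \<open>\<mu>(S)\<close> for the shifted matching polynomial of the subgraph of H induced by S. Take for
  \<open>\<lambda>\<close> the largest zero among all \<open>\<mu>(S)\<close>, with S a set of vertices of H. Every \<open>\<mu>(S)\<close> is nonnegative
  on \<open>[\<lambda>, \<infinity>)\<close>. If S is a minimal set with \<open>\<mu>(S)(\<lambda>) = 0\<close> and t is a vertex outside S with a
  neighbour v in S, the deletion recurrence
  \<open>\<mu>(S + t) = (x - w t) \<mu>(S) - (\<Sum> v. \<mu>(S - v))\<close> forces \<open>\<mu>(S - v)(\<lambda>) = 0\<close>, contradicting minimality.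
  So for connected H only \<open>\<mu>(V)\<close> vanishes at \<open>\<lambda>\<close>, where V is the set of all vertices. Its derivative
  \<open>\<Sum> v. \<mu>(V - v)\<close> is then positive at \<open>\<lambda>\<close>, and by the same recurrence \<open>p \<mapsto> \<mu>(V - set p)(\<lambda>)\<close> is a
  positive eigenvector of the path-tree matrix for \<open>\<lambda>\<close>, which makes \<open>\<lambda>\<close> its largest eigenvalue.
\<close>

section \<open>Matching polynomials of induced subgraphs\<close>

text \<open>Keeping one ambient graph and varying only the vertex set lets every vertex deletion be
  written as a set difference.\<close>

definition induced :: "'a pair_pre_digraph \<Rightarrow> 'a set \<Rightarrow> 'a pair_pre_digraph" where
  "induced H S = \<lparr>pverts = S, parcs = parcs H \<inter> S \<times> S\<rparr>"

lemma pverts_induced [simp]: "pverts (induced H S) = S"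
  by (simp add: induced_def)

lemma (in pair_wf_digraph) induced_pverts [simp]: "induced G (pverts G) = G"
proof -
  have "parcs G \<inter> pverts G \<times> pverts G = parcs G"
    by (auto dest: in_arcsD1 in_arcsD2)
  then show ?thesis by (simp add: induced_def)
qed

lemma edges_induced: "edges (induced H S) = {e \<in> edges H. e \<subseteq> S}"
  unfolding edges_def induced_def by auto

lemma matchings_induced:
  "M \<in> matchings (induced H S) \<longleftrightarrow> M \<in> matchings H \<and> \<Union>M \<subseteq> S"
  unfolding matchings_def edges_induced by auto

lemma matchings_subset_edges: "M \<in> matchings H \<Longrightarrow> M \<subseteq> edges H"
  and matchings_disjoint: "M \<in> matchings H \<Longrightarrow> e \<in> M \<Longrightarrow> f \<in> M \<Longrightarrow> e \<noteq> f \<Longrightarrow> e \<inter> f = {}"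
  by (auto simp: matchings_def)

lemma matchings_mono: "M \<in> matchings H \<Longrightarrow> N \<subseteq> M \<Longrightarrow> N \<in> matchings H"
  by (simp add: matchings_def) (meson order_trans subsetD)

lemma finite_matchings_induced:
  assumes "finite S"
  shows "finite (matchings (induced H S))"
proof (rule finite_subset)
  show "matchings (induced H S) \<subseteq> Pow (Pow S)"
    unfolding matchings_def edges_induced by blast
  show "finite (Pow (Pow S))" using assms by simp
qed

lemma matching_poly_induced:
  "matching_poly (induced H S) x =
     (\<Sum>M\<in>matchings (induced H S). (-1) ^ card M * (\<Prod>v\<in>S - \<Union>M. x v))"
  by (simp add: matching_poly_def)

lemma matching_poly_empty [simp]: "matching_poly (induced H {}) x = 1"
proof -
  have "matchings (induced H {}) = {{}}"
    unfolding matchings_def edges_induced by (auto simp: edges_def)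
  then show ?thesis by (simp add: matching_poly_induced)
qed

context pair_graph
begin

lemma edges_incident_cases:
  assumes "e \<in> edges G" "t \<in> e"
  obtains v where "e = {t, v}" "(t, v) \<in> parcs G" "v \<noteq> t"
proof -
  from assms(1) obtain a b where ab: "e = {a, b}" "(a, b) \<in> parcs G"
    by (auto simp: edges_def)
  have "(b, a) \<in> parcs G"
    using ab(2) pair_sym_arcs by (auto simp: symmetric_def sym_def)
  moreover have "a \<noteq> b" using pair_no_loops[OF ab(2)] by simp
  ultimately show thesis using that ab assms(2) by (auto simp: insert_commute)
qed

text \<open>A matching either leaves t uncovered, and then lives on S, or contains a unique edge {t,
  v}; removing that edge leaves a matching that avoids both t and v.\<close>

lemma matchings_induced_insert:
  assumes "t \<notin> S"
  shows "matchings (induced G (insert t S)) =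
    matchings (induced G S) \<union>
    (\<Union>v\<in>{v \<in> S. (t, v) \<in> parcs G}. insert {t, v} ` matchings (induced G (S - {v})))"
    (is "?L = ?A \<union> ?B")
proof (intro equalityI subsetI)
  fix M assume M: "M \<in> ?L"
  show "M \<in> ?A \<union> ?B"
  proof (cases "t \<in> \<Union>M")
    case False
    then show ?thesis using M by (auto simp: matchings_induced)
  next
    case True
    then obtain e where e: "e \<in> M" "t \<in> e" by auto
    have "e \<in> edges G" using M e matchings_subset_edges by (auto simp: matchings_induced)
    then obtain v where v: "e = {t, v}" "(t, v) \<in> parcs G" "v \<noteq> t"
      using e(2) by (rule edges_incident_cases)
    have "e \<subseteq> insert t S" using M e by (auto simp: matchings_induced)
    with v have vS: "v \<in> S" by auto
    have disj: "f \<inter> {t, v} = {}" if "f \<in> M - {e}" for f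
      using M that e(1) v(1) matchings_disjoint[of M G f e] by (auto simp: matchings_induced)
    have "M - {e} \<in> matchings (induced G (S - {v}))"
      unfolding matchings_induced
    proof
      show "M - {e} \<in> matchings G" using M matchings_mono[of M G "M - {e}"] by (auto simp: matchings_induced)
      show "\<Union>(M - {e}) \<subseteq> S - {v}"
        using M disj unfolding matchings_induced by blast
    qed
    moreover have "M = insert {t, v} (M - {e})" using e v by auto
    ultimately have "M \<in> insert {t, v} ` matchings (induced G (S - {v}))" by (rule rev_image_eqI)
    then show ?thesis using v vS by blast
  qed
next
  fix M assume "M \<in> ?A \<union> ?B"
  then show "M \<in> ?L"
  proof
    assume "M \<in> ?A"
    then show ?thesis by (auto simp: matchings_induced)
  next
    assume "M \<in> ?B"
    then obtain v N where v: "v \<in> S" "(t, v) \<in> parcs G" "M = insert {t, v} N"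
      and N: "N \<in> matchings (induced G (S - {v}))" by auto
    have "{t, v} \<in> edges G" using v by (auto simp: edges_def)
    moreover have "{t, v} \<inter> f = {}" if "f \<in> N" for f
      using N that assms unfolding matchings_induced by blast
    ultimately have "M \<in> matchings G"
      using N[unfolded matchings_induced] v(3) unfolding matchings_def by blast
    moreover have "\<Union>M \<subseteq> insert t S"
      using N v unfolding matchings_induced by blast
    ultimately show ?thesis by (simp add: matchings_induced)
  qed
qed

text \<open>An uncovered t contributes the factor \<open>x t\<close>. An edge {t, v} contributes a
  sign and removes both of its endpoints from the product.\<close>

lemma matching_poly_insert:
  fixes x :: "'a \<Rightarrow> 'r::comm_ring_1"
  assumes t: "t \<notin> S" and S: "finite S"
  shows "matching_poly (induced G (insert t S)) x =
    x t * matching_poly (induced G S) x -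
    (\<Sum>v\<in>{v \<in> S. (t, v) \<in> parcs G}. matching_poly (induced G (S - {v})) x)"
proof -
  let ?m = "\<lambda>S. matchings (induced G S)"
  let ?N = "{v \<in> S. (t, v) \<in> parcs G}"
  let ?f = "\<lambda>M. (-1) ^ card M * (\<Prod>v\<in>insert t S - \<Union>M. x v)"
  \<comment> \<open>This one fact makes the pieces of the decomposition disjoint,
    \<open>insert {t, v}\<close> injective, and the edge count grow by exactly one.\<close>
  have notin: "{t, v} \<notin> M" if "M \<in> ?m S'" "t \<notin> S'" for M v S'
    using that by (auto simp: matchings_induced)
  have "matching_poly (induced G (insert t S)) x =
      sum ?f (?m S \<union> (\<Union>v\<in>?N. insert {t, v} ` ?m (S - {v})))"
    by (simp add: matching_poly_induced matchings_induced_insert[OF t])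
  also have "\<dots> = sum ?f (?m S) + sum ?f (\<Union>v\<in>?N. insert {t, v} ` ?m (S - {v}))"
    using S t notin by (intro sum.union_disjoint) (auto simp: finite_matchings_induced)
  also have "sum ?f (?m S) = x t * matching_poly (induced G S) x"
    unfolding matching_poly_induced sum_distrib_left
  proof (rule sum.cong)
    fix M assume "M \<in> ?m S"
    then have "insert t S - \<Union>M = insert t (S - \<Union>M)"
      using t by (auto simp: matchings_induced)
    then show "?f M = x t * ((-1) ^ card M * (\<Prod>v\<in>S - \<Union>M. x v))"
      using S t by (simp add: mult.left_commute)
  qed simp
  also have "sum ?f (\<Union>v\<in>?N. insert {t, v} ` ?m (S - {v})) =
      (\<Sum>v\<in>?N. sum ?f (insert {t, v} ` ?m (S - {v})))"
  proof (rule sum.UNION_disjoint)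
    show "\<forall>v\<in>?N. \<forall>v'\<in>?N. v \<noteq> v' \<longrightarrow>
        insert {t, v} ` ?m (S - {v}) \<inter> insert {t, v'} ` ?m (S - {v'}) = {}"
    proof (intro ballI impI, rule ccontr)
      fix v v' assume *: "v \<in> ?N" "v' \<in> ?N" "v \<noteq> v'"
        and "insert {t, v} ` ?m (S - {v}) \<inter> insert {t, v'} ` ?m (S - {v'}) \<noteq> {}"
      then obtain M M' where "M' \<in> ?m (S - {v'})" "insert {t, v} M = insert {t, v'} M'"
        by blast
      moreover have "{t, v} \<noteq> {t, v'}" using * by (auto simp: doubleton_eq_iff)
      ultimately show False using notin[of M' "S - {v'}" v] t by auto
    qed
  qed (use S in \<open>auto simp: finite_matchings_induced\<close>)
  also have "\<dots> = (\<Sum>v\<in>?N. - matching_poly (induced G (S - {v})) x)"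
  proof (rule sum.cong)
    fix v assume v: "v \<in> ?N"
    have "inj_on (insert {t, v}) (?m (S - {v}))"
      using notin t by (intro inj_onI) (metis Diff_iff insert_ident)
    then have "sum ?f (insert {t, v} ` ?m (S - {v})) = (\<Sum>M\<in>?m (S - {v}). ?f (insert {t, v} M))"
      by (simp add: sum.reindex)
    also have "\<dots> = (\<Sum>M\<in>?m (S - {v}). - ((-1) ^ card M * (\<Prod>v\<in>S - {v} - \<Union>M. x v)))"
    proof (rule sum.cong)
      fix M assume M: "M \<in> ?m (S - {v})"
      have "finite M"
        using M S by (intro finite_subset[of M "Pow S"]) (auto simp: matchings_induced)
      then have "card (insert {t, v} M) = Suc (card M)"
        using notin[OF M] t by simp
      moreover have "insert t S - \<Union>(insert {t, v} M) = S - {v} - \<Union>M"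
        using t by auto
      ultimately show "?f (insert {t, v} M) = - ((-1) ^ card M * (\<Prod>v\<in>S - {v} - \<Union>M. x v))"
        by simp
    qed simp
    finally show "sum ?f (insert {t, v} ` ?m (S - {v})) = - matching_poly (induced G (S - {v})) x"
      by (simp add: matching_poly_induced sum_negf)
  qed simp
  finally show ?thesis by (simp add: sum_negf)
qed

end

text \<open>By the product rule, differentiation removes one uncovered vertex v at a time, and a
  matching of S that leaves v uncovered is just a matching of S - {v}.\<close>

lemma pderiv_matching_poly:
  fixes w :: "'a \<Rightarrow> real"
  assumes "finite S"
  shows "pderiv (matching_poly (induced H S) (\<lambda>v. [:- w v, 1:])) =
    (\<Sum>v\<in>S. matching_poly (induced H (S - {v})) (\<lambda>v. [:- w v, 1:]))"
proof -
  let ?m = "\<lambda>S. matchings (induced H S)" and ?x = "\<lambda>v. [:- w v, 1:]"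
  have c: "pderiv ((-1) ^ n * p) = (-1) ^ n * pderiv p" for n and p :: "real poly"
    by (cases "even n") (simp_all add: pderiv_minus)
  have m: "M \<in> ?m (S - {v}) \<longleftrightarrow> M \<in> ?m S \<and> v \<notin> \<Union>M" if "v \<in> S" for M v
    unfolding matchings_induced by blast
  have "pderiv (matching_poly (induced H S) ?x) =
      (\<Sum>M\<in>?m S. \<Sum>v\<in>S - \<Union>M. (-1) ^ card M * prod ?x (S - \<Union>M - {v}))"
    by (simp add: matching_poly_induced higher_pderiv_sum[where n=1, simplified] c pderiv_prod pderiv_pCons
        sum_distrib_left)
  also have "\<dots> = (\<Sum>v\<in>S. \<Sum>M\<in>?m (S - {v}). (-1) ^ card M * prod ?x (S - {v} - \<Union>M))"
    \<comment> \<open>Both double sums run over the same pairs of a matching and a vertex it leaves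
      uncovered, taken in opposite order.\<close>
    unfolding sum.Sigma[OF finite_matchings_induced[OF assms] ballI[OF finite_Diff[OF assms]]]
      sum.Sigma[OF assms ballI[OF finite_matchings_induced[OF finite_Diff[OF assms]]]]
    by (rule sum.reindex_bij_witness[where i="\<lambda>(v, M). (M, v)" and j="\<lambda>(M, v). (v, M)"])
      (auto simp: m intro!: arg_cong[where f="prod ?x"])
  finally show ?thesis by (simp add: matching_poly_induced)
qed

section \<open>The largest zero\<close>

text \<open>This bounds the zeros from above. Monotonicity under deletion is carried through the
  induction because it controls the subtracted terms of the recurrence: at most n of them, each at
  most the value at S - {t}.\<close>

lemma (in pair_graph) matching_poly_eventually_pos:
  fixes w :: "'a \<Rightarrow> real"
  assumes "finite S" and "\<And>v. v \<in> S \<Longrightarrow> w v + card S \<le> y"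
  shows "0 < poly (matching_poly (induced G S) (\<lambda>v. [:- w v, 1:])) y \<and>
    (\<forall>t\<in>S. poly (matching_poly (induced G (S - {t})) (\<lambda>v. [:- w v, 1:])) y
           \<le> poly (matching_poly (induced G S) (\<lambda>v. [:- w v, 1:])) y)"
  using assms
proof (induction "card S" arbitrary: S)
  case 0
  then show ?case by simp
next
  case (Suc n)
  let ?p = "\<lambda>S. poly (matching_poly (induced G S) (\<lambda>v. [:- w v, 1:])) y"
  have step: "0 < ?p (S - {t})" "?p (S - {t}) \<le> ?p S" if t: "t \<in> S" for t
  proof -
    let ?S = "S - {t}" and ?N = "{v \<in> S - {t}. (t, v) \<in> parcs G}"
    have n: "card ?S = n" using Suc t by simp
    have IH: "0 < ?p ?S \<and> (\<forall>v\<in>?S. ?p (?S - {v}) \<le> ?p ?S)"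
      using Suc.prems Suc.hyps(2) n by (intro Suc.hyps(1)) fastforce+
    then show pos: "0 < ?p ?S" by simp
    have "(\<Sum>v\<in>?N. ?p (?S - {v})) \<le> (\<Sum>v\<in>?N. ?p ?S)"
      using IH by (intro sum_mono) auto
    also have "\<dots> = card ?N * ?p ?S" by simp
    also have "\<dots> \<le> n * ?p ?S"
      using pos Suc.prems(1) n by (intro mult_right_mono) (auto intro: card_mono)
    finally have "(\<Sum>v\<in>?N. ?p (?S - {v})) \<le> n * ?p ?S" .
    moreover have "?p (insert t ?S) = (y - w t) * ?p ?S - (\<Sum>v\<in>?N. ?p (?S - {v}))"
      using Suc.prems(1) by (subst matching_poly_insert) (auto simp: poly_sum algebra_simps)
    \<comment> \<open>Since \<open>card S\<close> is n + 1, the leading term exceeds the subtracted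
      sum by at least one copy of \<open>?p ?S\<close>.\<close>
    moreover have "(n + 1) * ?p ?S \<le> (y - w t) * ?p ?S"
      using pos Suc.prems(2)[OF t] Suc.hyps(2) by (intro mult_right_mono) auto
    ultimately show "?p ?S \<le> ?p S"
      using t by (simp add: insert_absorb algebra_simps)
  qed
  moreover obtain t where "t \<in> S" using Suc.hyps(2) by fastforce
  ultimately show ?case by force
qed

text \<open>A walk from a vertex in S to one outside must leave S at some arc. Symmetry allows
  passing from the symmetric closure to G and reversing that arc.\<close>

lemma (in pair_graph) connected_crossing_arc:
  assumes "Digraph_Component.connected (with_proj G)" and "S \<subset> pverts G" "S \<noteq> {}"
  obtains t v where "t \<in> pverts G - S" "v \<in> S" "(t, v) \<in> parcs G"
proof -
  from assms obtain a b where a: "a \<in> pverts G" "a \<notin> S" and b: "b \<in> S" "b \<in> pverts G" by blast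
  have "b \<rightarrow>\<^sup>*\<^bsub>mk_symmetric (with_proj G)\<^esub> a"
    using assms(1) a b by (auto simp: Digraph_Component.connected_def strongly_connected_def mk_symmetric_def)
  then have "b \<rightarrow>\<^sup>*\<^bsub>with_proj G\<^esub> a"
    using reachable_mk_symmetric_eq[OF pair_sym_arcs] by simp
  then have "a \<in> S \<or> (\<exists>t v. t \<in> pverts G - S \<and> v \<in> S \<and> (v, t) \<in> parcs G)"
  proof (induction rule: reachable_induct)
    case (step c d)
    then show ?case using in_arcsD2 by auto
  qed (use b in simp)
  then show thesis
    using that a pair_sym_arcs by (auto simp: symmetric_def sym_def)
qed

text \<open>Strict positivity on proper subsets serves twice later: for the positive eigenvector and
  for the simplicity of the zero.\<close>

lemma (in pair_graph) largest_zero: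
  fixes w :: "'a \<Rightarrow> real"
  defines "\<mu> \<equiv> \<lambda>S. matching_poly (induced G S) (\<lambda>v. [:- w v, 1:])"
  assumes conn: "Digraph_Component.connected (with_proj G)"
  shows "\<exists>l. poly (\<mu> (pverts G)) l = 0 \<and> (\<forall>S. S \<subset> pverts G \<longrightarrow> 0 < poly (\<mu> S) l) \<and>
    (\<forall>y>l. 0 < poly (\<mu> (pverts G)) y)"
proof -
  let ?V = "pverts G"
  have fin: "finite S" if "S \<subseteq> ?V" for S
    using that pair_finite_verts finite_subset by blast
  obtain u where u: "u \<in> ?V"
    using conn by (auto simp: Digraph_Component.connected_def strongly_connected_def mk_symmetric_def)
  \<comment> \<open>The witness, the largest weight plus the number of vertices, works for all S at
    once.\<close>
  obtain B where B: "\<And>S y. S \<subseteq> ?V \<Longrightarrow> B \<le> y \<Longrightarrow> 0 < poly (\<mu> S) y"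
  proof
    fix S y assume S: "S \<subseteq> ?V" and y: "Max (w ` ?V) + card ?V \<le> y"
    have "w v + card S \<le> y" if "v \<in> S" for v
    proof -
      have "w v \<le> Max (w ` ?V)" using that S pair_finite_verts by (intro Max_ge) auto
      moreover have "card S \<le> card ?V" using S pair_finite_verts by (intro card_mono)
      ultimately show ?thesis using y by linarith
    qed
    then show "0 < poly (\<mu> S) y"
      using matching_poly_eventually_pos[of S w y] fin[OF S] by (simp add: \<mu>_def)
  qed
  define Z where "Z = (\<Union>S\<in>Pow ?V. {y. poly (\<mu> S) y = 0})"
  define l where "l = Max Z"
  have "\<mu> S \<noteq> 0" if "S \<subseteq> ?V" for S
    using B[OF that, of B] by auto
  then have "finite Z"
    unfolding Z_def using pair_finite_verts by (auto intro: poly_roots_finite)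
  \<comment> \<open>The one-vertex polynomial x - w u guarantees that the maximum is taken over a
    nonempty set.\<close>
  moreover have "w u \<in> Z"
  proof -
    have "poly (\<mu> {u}) (w u) = 0"
      using matching_poly_insert[of u "{}" "\<lambda>v. [:- w v, 1:]"] by (simp add: \<mu>_def)
    then show ?thesis using u by (auto simp: Z_def)
  qed
  ultimately have "l \<in> Z" and max: "\<And>y. y \<in> Z \<Longrightarrow> y \<le> l"
    unfolding l_def using Max_in by auto
  have nz: "poly (\<mu> S) y \<noteq> 0" if "S \<subseteq> ?V" "l < y" for S y
    using max[of y] that by (auto simp: Z_def)
  have nonneg: "0 \<le> poly (\<mu> S) y" if S: "S \<subseteq> ?V" and y: "l \<le> y" for S y
  proof (rule ccontr)
    assume "\<not> 0 \<le> poly (\<mu> S) y"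
    \<comment> \<open>Taking the maximum with y + 1 puts the comparison point strictly to the right
      of y, so a sign change would give a zero beyond l.\<close>
    moreover have "0 < poly (\<mu> S) (max B (y + 1))" using B[OF S] by simp
    ultimately obtain z where "y < z" "poly (\<mu> S) z = 0"
      using poly_IVT_pos[of y "max B (y + 1)" "\<mu> S"] by (auto simp: less_max_iff_disj)
    then show False using nz[OF S] y by force
  qed
  have zero_imp: "S = ?V" if "S \<subseteq> ?V" "poly (\<mu> S) l = 0" for S
    using fin[OF that(1)] that
  proof (induction rule: finite_psubset_induct)
    case (psubset S)
    show ?case
    proof (rule ccontr)
      assume "S \<noteq> ?V"
      moreover have "S \<noteq> {}" using psubset.prems(2) by (auto simp: \<mu>_def)
      ultimately obtain t v where tv: "t \<in> ?V - S" "v \<in> S" "(t, v) \<in> parcs G"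
        using connected_crossing_arc[OF conn] psubset.prems(1) by blast
      let ?N = "{v \<in> S. (t, v) \<in> parcs G}"
      have sub: "S - {v} \<subseteq> ?V" for v using psubset.prems(1) by auto
      \<comment> \<open>The leading term vanishes at l, so a nonnegative value equals minus a sum of
        nonnegative terms; every term must be zero.\<close>
      have "poly (\<mu> (insert t S)) l = - (\<Sum>v\<in>?N. poly (\<mu> (S - {v})) l)"
        using tv(1) psubset by (simp add: \<mu>_def matching_poly_insert poly_sum)
      moreover have "0 \<le> poly (\<mu> (insert t S)) l"
        using tv(1) psubset.prems(1) by (intro nonneg) auto
      moreover have "poly (\<mu> (S - {v})) l \<le> (\<Sum>v\<in>?N. poly (\<mu> (S - {v})) l)"
        using tv psubset.hyps(1) sub by (intro member_le_sum nonneg) auto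
      ultimately have "poly (\<mu> (S - {v})) l = 0"
        using nonneg[OF sub, of l v] by simp
      then have "S - {v} = ?V" using psubset.IH[of "S - {v}"] tv sub by blast
      then show False using tv psubset.prems by blast
    qed
  qed
  show ?thesis
  proof (intro exI[of _ l] conjI allI impI)
    show "poly (\<mu> ?V) l = 0" using \<open>l \<in> Z\<close> zero_imp by (auto simp: Z_def)
    show "0 < poly (\<mu> S) l" if "S \<subset> ?V" for S
      using nonneg[of S l] zero_imp[of S] that by force
    show "0 < poly (\<mu> ?V) y" if "l < y" for y
      using nonneg[of ?V y] nz[of ?V y] that by force
  qed
qed

section \<open>Matrices with a positive eigenvector\<close>

text \<open>A Perron-Frobenius comparison: any real eigenvector g is measured against the positive
  eigenvector f at an index where the ratio of the absolute value of g to f is maximal.\<close>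

lemma largest_eigenvalue_positive_eigenvector:
  fixes A :: "real mat"
  assumes A: "A \<in> carrier_mat n n" and n: "0 < n"
    and off: "\<And>i j. i < n \<Longrightarrow> j < n \<Longrightarrow> i \<noteq> j \<Longrightarrow> 0 \<le> A $$ (i, j)"
    and pos: "\<And>i. i < n \<Longrightarrow> 0 < f i"
    and eig: "\<And>i. i < n \<Longrightarrow> (\<Sum>j<n. A $$ (i, j) * f j) = l * f i"
  shows "largest_eigenvalue A = l"
  unfolding largest_eigenvalue_def
proof (rule Max_eqI)
  show "finite (spectrum A)" by (rule card_finite_spectrum(1)[OF A])
  have "eigenvector A (vec n f) l"
    unfolding eigenvector_def
  proof (intro conjI)
    show "vec n f \<noteq> 0\<^sub>v (dim_row A)"
    proof
      assume "vec n f = 0\<^sub>v (dim_row A)"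
      then have "vec n f $ 0 = 0\<^sub>v (dim_row A) $ 0" by simp
      then show False using n A pos[of 0] by simp
    qed
    show "A *\<^sub>v vec n f = l \<cdot>\<^sub>v vec n f"
      using A eig by (auto simp: scalar_prod_def lessThan_atLeast0)
  qed (use A in auto)
  then show "l \<in> spectrum A" by (auto simp: spectrum_def eigenvalue_def)
next
  fix m assume "m \<in> spectrum A"
  then obtain g where g: "g \<in> carrier_vec n" "g \<noteq> 0\<^sub>v n" "A *\<^sub>v g = m \<cdot>\<^sub>v g"
    using A by (auto simp: spectrum_def eigenvalue_def eigenvector_def)
  define r where "r = (\<lambda>i. \<bar>g $ i\<bar> / f i)"
  define c where "c = Max (r ` {..<n})"
  have "c \<in> r ` {..<n}" unfolding c_def using n by (intro Max_in) auto
  then obtain i where i: "i < n" "c = r i" by auto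
  have le: "\<bar>g $ j\<bar> \<le> c * f j" if "j < n" for j
  proof -
    have "r j \<le> c" unfolding c_def using that by (intro Max_ge) auto
    then show ?thesis using pos[OF that] by (simp add: r_def field_simps)
  qed
  have gi: "\<bar>g $ i\<bar> = c * f i" using i pos[OF i(1)] by (simp add: r_def)
  \<comment> \<open>If the maximal ratio were zero, g would vanish everywhere. Positivity permits
    the final cancellation.\<close>
  have "0 < \<bar>g $ i\<bar>"
  proof (rule ccontr)
    assume "\<not> 0 < \<bar>g $ i\<bar>"
    then have "c = 0" using i by (simp add: r_def)
    then have "g = 0\<^sub>v n" using le g(1) by (intro eq_vecI) auto
    then show False using g(2) by simp
  qed
  \<comment> \<open>Isolating the diagonal entry leaves only nonnegative coefficients, so the bound
    on g can be applied termwise whatever the sign of the diagonal.\<close>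
  have split: "(\<Sum>j<n. A $$ (i, j) * h j) = A $$ (i, i) * h i + (\<Sum>j\<in>{..<n} - {i}. A $$ (i, j) * h j)" for h
    using i by (subst sum.remove[of _ i]) auto
  have "(\<Sum>j<n. A $$ (i, j) * g $ j) = (A *\<^sub>v g) $ i"
    using A g(1) i by (simp add: scalar_prod_def lessThan_atLeast0)
  also have "\<dots> = m * g $ i" unfolding g(3) using g(1) i by simp
  finally have "(m - A $$ (i, i)) * g $ i = (\<Sum>j\<in>{..<n} - {i}. A $$ (i, j) * g $ j)"
    unfolding split by (simp add: algebra_simps)
  then have "\<bar>\<Sum>j\<in>{..<n} - {i}. A $$ (i, j) * g $ j\<bar> = \<bar>m - A $$ (i, i)\<bar> * \<bar>g $ i\<bar>"
    by (metis abs_mult)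
  then have "(m - A $$ (i, i)) * \<bar>g $ i\<bar> \<le> \<bar>\<Sum>j\<in>{..<n} - {i}. A $$ (i, j) * g $ j\<bar>"
    by (simp add: mult_right_mono)
  also have "\<dots> \<le> (\<Sum>j\<in>{..<n} - {i}. A $$ (i, j) * (c * f j))"
    using i off le by (intro order.trans[OF sum_abs] sum_mono) (auto simp: abs_mult intro!: mult_left_mono)
  also have "\<dots> = c * (\<Sum>j\<in>{..<n} - {i}. A $$ (i, j) * f j)"
    by (simp add: sum_distrib_left algebra_simps)
  \<comment> \<open>Here the bound c * f is attained at i, so row i of the eigenvalue equation for
    f, scaled by c, evaluates the sum.\<close>
  also have "\<dots> = (l - A $$ (i, i)) * \<bar>g $ i\<bar>"
    using arg_cong[OF eig[OF i(1)], of "(*) c"] unfolding split gi by (simp add: algebra_simps)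
  finally show "m \<le> l" using \<open>0 < \<bar>g $ i\<bar>\<close> by simp
qed

section \<open>Path-trees\<close>

text \<open>As q repeats no vertex, p can occur in q only at the front; maximality then leaves room
  for just one more vertex.\<close>

lemma max_proper_subpath_same_hd:
  assumes "distinct q" and "p \<noteq> []" "hd p = hd q"
  shows "max_proper_subpath p q \<longleftrightarrow> (\<exists>v. q = p @ [v])"
proof
  assume *: "max_proper_subpath p q"
  then obtain as bs where q: "q = as @ p @ bs" and "p \<noteq> q"
    by (auto simp: max_proper_subpath_def strict_sublist_def sublist_def)
  have "as = []"
  proof (rule ccontr)
    assume "as \<noteq> []"
    then have "hd q \<in> set as" "hd p \<in> set p" using q assms(2) by auto
    then show False using q assms by auto
  qed
  with q \<open>p \<noteq> q\<close> obtain v cs where cs: "q = p @ v # cs" by (cases bs) auto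
  have "strict_sublist p (p @ [v])" by (auto simp: strict_sublist_def)
  with * have "\<not> strict_sublist (p @ [v]) q" unfolding max_proper_subpath_def by blast
  moreover have "sublist (p @ [v]) q" unfolding sublist_def using cs by force
  ultimately show "\<exists>v. q = p @ [v]" by (auto simp: strict_sublist_def)
next
  assume "\<exists>v. q = p @ [v]"
  then obtain v where q: "q = p @ [v]" by auto
  \<comment> \<open>No list can have a length strictly between those of p and p @ [v].\<close>
  have less: "length a < length b" if "strict_sublist a b" for a b :: "'a list"
    using that by (auto simp: strict_sublist_def sublist_def)
  show "max_proper_subpath p q"
    unfolding max_proper_subpath_def
  proof (intro conjI notI)
    show "strict_sublist p q" using q by (auto simp: strict_sublist_def)
    assume "\<exists>r. strict_sublist p r \<and> strict_sublist r q"
    then show False using q by (auto dest!: less)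
  qed
qed

text \<open>The neighbours are the one-vertex extensions of p and, except at the root, the path with
  its last vertex dropped.\<close>

lemma path_tree_neighbours:
  assumes p: "p \<in> paths_from H u"
  shows "{q \<in> paths_from H u. (p, q) \<in> parcs (path_tree H u)} =
    (\<lambda>v. p @ [v]) ` {v \<in> pverts H - set p. (last p, v) \<in> parcs H} \<union>
    (if p = [u] then {} else {butlast p})"
proof -
  have ne: "q \<noteq> [] \<and> distinct q \<and> hd q = u" if "q \<in> paths_from H u" for q
    using that by (auto simp: paths_from_def vpath_def vwalk_def)
  have snoc: "q @ [v] \<in> paths_from H u \<longleftrightarrow>
      q \<in> paths_from H u \<and> v \<in> pverts H - set q \<and> (last q, v) \<in> parcs H" if "q \<noteq> []" for q v
    using that by (auto simp: paths_from_def vpath_def vwalk_def set_vwalk_arcs_snoc)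
  have adj: "(p, q) \<in> parcs (path_tree H u) \<longleftrightarrow> (\<exists>v. q = p @ [v]) \<or> (\<exists>v. p = q @ [v])"
    if "q \<in> paths_from H u" for q
    using p that ne[OF p] ne[OF that] by (simp add: path_tree_def max_proper_subpath_same_hd)
  have children: "{q \<in> paths_from H u. \<exists>v. q = p @ [v]} =
      (\<lambda>v. p @ [v]) ` {v \<in> pverts H - set p. (last p, v) \<in> parcs H}"
    using p snoc[of p] ne[OF p] by auto
  have parent: "{q \<in> paths_from H u. \<exists>v. p = q @ [v]} = (if p = [u] then {} else {butlast p})"
  proof (cases "p = [u]")
    case True
    then show ?thesis using ne by (auto simp: Cons_eq_append_conv)
  next
    case False
    then obtain q v where q: "p = q @ [v]" "q \<noteq> []"
      using ne[OF p] by (metis append_Nil list.sel(1) rev_exhaust)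
    then have "q \<in> paths_from H u" using p snoc by simp
    then show ?thesis using q by auto
  qed
  have "{q \<in> paths_from H u. (p, q) \<in> parcs (path_tree H u)} =
      {q \<in> paths_from H u. \<exists>v. q = p @ [v]} \<union> {q \<in> paths_from H u. \<exists>v. p = q @ [v]}"
    using adj by blast
  then show ?thesis unfolding children parent .
qed

text \<open>This is the deletion recurrence with t = \<open>last p\<close> and S the vertices off p:
  the children of p give the terms S - {v}, and its parent gives S with t put back.\<close>

lemma (in pair_graph) path_tree_eigenvector:
  fixes w :: "'a \<Rightarrow> real"
  defines "\<mu> \<equiv> \<lambda>S. matching_poly (induced G S) (\<lambda>v. [:- w v, 1:])"
  assumes zero: "poly (\<mu> (pverts G)) l = 0" and p: "p \<in> paths_from G u"
  shows "w (last p) * poly (\<mu> (pverts G - set p)) l +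
    (\<Sum>q\<in>{q \<in> paths_from G u. (p, q) \<in> parcs (path_tree G u)}. poly (\<mu> (pverts G - set q)) l) =
    l * poly (\<mu> (pverts G - set p)) l"
proof -
  let ?V = "pverts G" and ?f = "\<lambda>p. poly (\<mu> (pverts G - set p)) l"
  let ?C = "{v \<in> pverts G - set p. (last p, v) \<in> parcs G}"
  have p': "p \<noteq> []" "distinct p" "hd p = u" "set p \<subseteq> ?V"
    using p by (auto simp: paths_from_def vpath_def vwalk_def)
  have "sum ?f {q \<in> paths_from G u. (p, q) \<in> parcs (path_tree G u)} =
      sum ?f ((\<lambda>v. p @ [v]) ` ?C) + sum ?f (if p = [u] then {} else {butlast p})"
    unfolding path_tree_neighbours[OF p]
    by (rule sum.union_disjoint) (use pair_finite_verts in \<open>auto dest: arg_cong[where f=length]\<close>)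
  also have "sum ?f ((\<lambda>v. p @ [v]) ` ?C) = (\<Sum>v\<in>?C. poly (\<mu> (?V - set p - {v})) l)"
    by (subst sum.reindex) (auto simp: inj_on_def intro!: sum.cong arg_cong[where f="\<lambda>S. poly (\<mu> S) l"])
  \<comment> \<open>The root has no parent, but its \<open>butlast\<close> is empty, and the
    corresponding value is that of the full vertex set, which vanishes at l.\<close>
  also have "sum ?f (if p = [u] then {} else {butlast p}) = ?f (butlast p)"
    using zero by auto
  also have "?V - set (butlast p) = insert (last p) (?V - set p)"
  proof -
    have "p = butlast p @ [last p]" using p' by simp
    then have "set p = insert (last p) (set (butlast p))" "last p \<notin> set (butlast p)"
      using p'(2) by (metis Un_insert_right list.simps(15) set_append sup_bot_right list.set(1),
          metis distinct_append not_distinct_conv_prefix)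
    then show ?thesis using p' by auto
  qed
  also have "poly (\<mu> (insert (last p) (?V - set p))) l =
      (l - w (last p)) * ?f p - (\<Sum>v\<in>?C. poly (\<mu> (?V - set p - {v})) l)"
    using p' pair_finite_verts by (simp add: \<mu>_def matching_poly_insert poly_sum algebra_simps)
  finally show ?thesis by (simp add: algebra_simps)
qed

lemma (in pair_graph) largest_eigenvalue_path_tree:
  fixes K :: "'a pair_pre_digraph"
  defines "\<mu> \<equiv> \<lambda>S. matching_poly (induced G S) (\<lambda>v. [:- real (deg K v), 1:])"
  assumes u: "u \<in> pverts G" and ps: "vertex_enum (path_tree G u) ps"
    and zero: "poly (\<mu> (pverts G)) l = 0"
    and pos: "\<And>S. S \<subset> pverts G \<Longrightarrow> 0 < poly (\<mu> S) l"
  shows "largest_eigenvalue (terminal_degree_mat K ps + adjacency_mat (path_tree G u) ps) = l"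
proof -
  let ?A = "terminal_degree_mat K ps + adjacency_mat (path_tree G u) ps"
  let ?n = "length ps" and ?f = "\<lambda>p. poly (\<mu> (pverts G - set p)) l"
  have ps': "distinct ps" "set ps = paths_from G u"
    using ps by (auto simp: vertex_enum_def path_tree_def)
  have "[u] \<in> set ps" using u by (simp add: ps' paths_from_def vpath_def vwalk_def)
  then have n: "0 < ?n" by (auto intro: length_pos_if_in_set)
  have A: "?A \<in> carrier_mat ?n ?n"
    by (auto simp: terminal_degree_mat_def adjacency_mat_def)
  have entry: "?A $$ (i, j) = (if i = j then real (deg K (last (ps ! i))) else 0) +
      (if (ps ! i, ps ! j) \<in> parcs (path_tree G u) then 1 else 0)" if "i < ?n" "j < ?n" for i j
    using that by (simp add: terminal_degree_mat_def adjacency_mat_def mat_diag_def)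
  show ?thesis
  proof (rule largest_eigenvalue_positive_eigenvector[OF A n])
    show "0 \<le> ?A $$ (i, j)" if "i < ?n" "j < ?n" "i \<noteq> j" for i j
      using that by (simp add: entry)
  next
    fix i assume "i < ?n"
    then have "ps ! i \<in> paths_from G u" using ps' nth_mem by blast
    \<comment> \<open>Every path contains u, so its complement is a proper subset and the entry is
      positive.\<close>
    then have "u \<in> set (ps ! i)"
      by (auto simp: paths_from_def vpath_def vwalk_def)
    then show "0 < ?f (ps ! i)" using u by (intro pos) auto
  next
    fix i assume i: "i < ?n"
    let ?p = "ps ! i"
    have p: "?p \<in> paths_from G u" using ps' i nth_mem by blast
    let ?e = "\<lambda>q. if (?p, q) \<in> parcs (path_tree G u) then ?f q else 0"
    have "(\<Sum>j<?n. ?A $$ (i, j) * ?f (ps ! j)) =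
        (\<Sum>j<?n. (if j = i then real (deg K (last ?p)) * ?f ?p else 0) + ?e (ps ! j))"
      using i by (intro sum.cong) (auto simp: entry algebra_simps)
    also have "\<dots> = real (deg K (last ?p)) * ?f ?p + (\<Sum>j<?n. ?e (ps ! j))"
      using i by (simp add: sum.distrib)
    also have "(\<Sum>j<?n. ?e (ps ! j)) = sum ?e (set ps)"
      using ps'(1) by (intro sum.reindex_bij_betw bij_betw_nth) auto
    also have "\<dots> = sum ?f {q \<in> paths_from G u. (?p, q) \<in> parcs (path_tree G u)}"
      using ps'(2)[symmetric] by (simp add: sum.inter_filter)
    also have "real (deg K (last ?p)) * ?f ?p + \<dots> = l * ?f ?p"
      using path_tree_eigenvector[OF zero[unfolded \<mu>_def] p] by (simp add: \<mu>_def)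
    finally show "(\<Sum>j<?n. ?A $$ (i, j) * ?f (ps ! j)) = l * ?f ?p" .
  qed
qed

section \<open>Largest root of a connected graph and its multiplicity\<close>

lemma (in pair_graph) shifted_matching_poly_induced:
  "shifted_matching_poly K G = matching_poly (induced G (pverts G)) (\<lambda>v. [:- real (deg K v), 1:])"
  unfolding shifted_matching_poly_def induced_pverts of_nat_poly by simp

text \<open>The degrees come from a separate graph K, so the result covers a subgraph with ambient
  degrees as well as the Laplacian case K = G.\<close>

lemma (in pair_graph) shifted_matching_poly_connected:
  assumes "Digraph_Component.connected (with_proj G)"
  shows "u \<in> pverts G \<Longrightarrow> vertex_enum (path_tree G u) ps \<Longrightarrow>
      largest_root (shifted_matching_poly K G) =
        largest_eigenvalue (terminal_degree_mat K ps + adjacency_mat (path_tree G u) ps)"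
    and "Polynomial.order (largest_root (shifted_matching_poly K G)) (shifted_matching_poly K G) = 1"
proof -
  let ?\<mu> = "\<lambda>S. matching_poly (induced G S) (\<lambda>v. [:- real (deg K v), 1:])"
  let ?V = "pverts G" and ?p = "shifted_matching_poly K G"
  obtain l where l: "poly (?\<mu> ?V) l = 0" "\<And>S. S \<subset> ?V \<Longrightarrow> 0 < poly (?\<mu> S) l"
      "\<And>y. l < y \<Longrightarrow> 0 < poly (?\<mu> ?V) y"
    using largest_zero[OF assms, of "\<lambda>v. real (deg K v)"] by metis
  have p: "?p = ?\<mu> ?V" by (rule shifted_matching_poly_induced)
  have nz: "?p \<noteq> 0" using l(3)[of "l + 1"] p by auto
  have root: "largest_root ?p = l"
    unfolding largest_root_def
  proof (rule Max_eqI)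
    show "finite {x. poly ?p x = 0}" using nz by (rule poly_roots_finite)
    show "y \<le> l" if "y \<in> {x. poly ?p x = 0}" for y
      using that l(3)[of y] p by force
    show "l \<in> {x. poly ?p x = 0}" using l(1) p by simp
  qed
  then show "largest_root ?p =
      largest_eigenvalue (terminal_degree_mat K ps + adjacency_mat (path_tree G u) ps)"
    if "u \<in> ?V" "vertex_enum (path_tree G u) ps"
    using largest_eigenvalue_path_tree[OF that l(1,2)] by simp
  have "?V \<noteq> {}"
    using assms by (auto simp: Digraph_Component.connected_def strongly_connected_def mk_symmetric_def)
  \<comment> \<open>This sum is the derivative at l; deleting any vertex leaves a proper subset, so
    each term is positive and the zero is simple.\<close>
  then have "0 < (\<Sum>v\<in>?V. poly (?\<mu> (?V - {v})) l)"
    using pair_finite_verts by (intro sum_pos l(2)) auto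
  then have "poly (pderiv ?p) l \<noteq> 0"
    unfolding p pderiv_matching_poly[OF pair_finite_verts] by (simp add: poly_sum)
  then have "Polynomial.order l (pderiv ?p) = 0" by (simp add: order_root)
  then show "Polynomial.order (largest_root ?p) ?p = 1"
    using order_pderiv[OF nz] l(1) p root by simp
qed

theorem theorem3p4:
  fixes G :: "'a pair_pre_digraph"
  assumes "pair_graph G" and "Digraph_Component.connected (with_proj G)"
  shows
    "(\<forall>H u ps.
        pair_graph H \<longrightarrow> subgraph (with_proj H) (with_proj G) \<longrightarrow> u \<in> pverts H \<longrightarrow>
        Digraph_Component.connected (with_proj H) \<longrightarrow> vertex_enum (path_tree H u) ps \<longrightarrow>
        largest_root (shifted_matching_poly G H) =
          largest_eigenvalue (terminal_degree_mat G ps + adjacency_mat (path_tree H u) ps)) \<and>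
     (\<forall>u ps.
        u \<in> pverts G \<longrightarrow> vertex_enum (path_tree G u) ps \<longrightarrow>
        largest_root (laplacian_matching_poly G) =
          largest_eigenvalue (terminal_degree_mat G ps + adjacency_mat (path_tree G u) ps)) \<and>
     Polynomial.order (largest_root (laplacian_matching_poly G)) (laplacian_matching_poly G) = 1"
  unfolding laplacian_matching_poly_def
  \<comment> \<open>The first fact is applied to H with degrees from G, the second to G
    itself.\<close>
  using pair_graph.shifted_matching_poly_connected(1)
    pair_graph.shifted_matching_poly_connected[OF assms]
  by (intro conjI allI impI)

end
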